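(* For every real $\lambda>0$ there is an algorithm for makespan scheduling with predictions on restricted-assignment machines under weighted binary budget uncertainty, restricted to instances in which every job $j$ with $p_j^+-p_j^->0$ satisfies $w_j\le\Gamma$, that has consistency $1+1/\lambda$ and robustness $4+2\lambda$. That is, for every such instance (numbers of machines $m$ and jobs $n$, eligibility sets, intervals $[p_j^-,p_j^+]$, weights $w_j>0$ and budget $\Gamma\ge0$, defining the uncertainty set $\mathcal U$) and every predicted scenario $\hat q\in\mathcal U$, the algorithm returns a schedule $\mathcal S$ with $$C_{\max}(\mathcal S,\hat q)\le\Big(1+\frac1\lambda\Big)\mathrm{OPT}(\hat q)\quad\text{and}\quad \max_{q\in\mathcal U}C_{\max}(\mathcal S,q)\le(4+2\lambda)\,\mathrm{OPT}^{\mathrm{rob}}(\mathcal U).$$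
   Context: There are $m$ machines and $n$ jobs. A scenario is a matrix $q$ with entries $q_{i,j}\in[0,\infty]$. A schedule is a partition $\mathcal S=(S_1,\dots,S_m)$ of $[n]$ (parts may be empty), and $C_{\max}(\mathcal S,q)=\max_{i\in[m]}\sum_{j\in S_i}q_{i,j}$. $\mathrm{OPT}(q)=\min_{\mathcal S}C_{\max}(\mathcal S,q)$ and $\mathrm{OPT}^{\mathrm{rob}}(\mathcal U)=\min_{\mathcal S}\max_{q\in\mathcal U}C_{\max}(\mathcal S,q)$. Restricted assignment: each job $j$ has a size $p_j\ge0$ and an eligibility set $M_j\subseteq[m]$, and $q_{i,j}=p_j$ if $i\in M_j$, $q_{i,j}=\infty$ otherwise. Weighted binary budget uncertainty: for given $0\le p_j^-\le p_j^+$, weights $w_j>0$ and $\Gamma\ge0$, $\mathcal U$ is the set of all scenarios obtained (with fixed eligibility sets) from size vectors $p$ for which there is $T\subseteq[n]$ with $\sum_{j\in T}w_j\le\Gamma$, $p_j=p_j^-$ for $j\notin T$ and $p_j\in[p_j^-,p_j^+]$ for $j\in T$. An algorithm is a map from inputs to schedules; no computational restriction is imposed. *)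

theory Defs
  imports "HOL-Library.Extended_Nonnegative_Real" "HOL-Library.FuncSet" "HOL-Library.Disjoint_Sets"
begin

text \<open>
  Machines are \<open>{1..m}\<close> and jobs are \<open>{1..n}\<close>. Finite families over these index sets are
  functions that are \<open>undefined\<close> outside of them, so that distinct functions are distinct families.
\<close>

type_synonym scenario = "nat \<Rightarrow> nat \<Rightarrow> ennreal"
type_synonym schedule = "nat \<Rightarrow> nat set"

definition schedules :: "nat \<Rightarrow> nat \<Rightarrow> schedule set" where
  "schedules m n = {S \<in> {1..m} \<rightarrow>\<^sub>E Pow {1..n}.
     disjoint_family_on S {1..m} \<and> (\<Union>i\<in>{1..m}. S i) = {1..n}}"

definition C_max :: "nat \<Rightarrow> schedule \<Rightarrow> scenario \<Rightarrow> ennreal" where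
  "C_max m S q = Max ((\<lambda>i. \<Sum>j\<in>S i. q i j) ` {1..m})"

definition OPT :: "nat \<Rightarrow> nat \<Rightarrow> scenario \<Rightarrow> ennreal" where
  "OPT m n q = Min ((\<lambda>S. C_max m S q) ` schedules m n)"

text \<open>For the uncertainty sets below this supremum is attained, see \<open>worst_case_attained\<close>.\<close>

definition worst_case :: "nat \<Rightarrow> schedule \<Rightarrow> scenario set \<Rightarrow> ennreal" where
  "worst_case m S U = (SUP q\<in>U. C_max m S q)"

definition OPT_rob :: "nat \<Rightarrow> nat \<Rightarrow> scenario set \<Rightarrow> ennreal" where
  "OPT_rob m n U = Min ((\<lambda>S. worst_case m S U) ` schedules m n)"

definition restricted_assignment ::
    "nat \<Rightarrow> nat \<Rightarrow> (nat \<Rightarrow> nat set) \<Rightarrow> (nat \<Rightarrow> real) \<Rightarrow> scenario" where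
  "restricted_assignment m n M p =
     (\<lambda>i\<in>{1..m}. \<lambda>j\<in>{1..n}. if i \<in> M j then ennreal (p j) else \<infinity>)"

record wbb_instance =
  machines :: nat
  jobs :: nat
  eligible :: "nat \<Rightarrow> nat set"
  size_lo :: "nat \<Rightarrow> real"
  size_hi :: "nat \<Rightarrow> real"
  weight :: "nat \<Rightarrow> real"
  budget :: real

text \<open>At least one machine is required, as otherwise there is no schedule of a nonempty job set.\<close>

definition valid_instance :: "wbb_instance \<Rightarrow> bool" where
  "valid_instance I \<longleftrightarrow>
     machines I \<ge> 1 \<and>
     eligible I \<in> {1..jobs I} \<rightarrow>\<^sub>E Pow {1..machines I} \<and>
     size_lo I \<in> {1..jobs I} \<rightarrow>\<^sub>E {0..} \<and>
     size_hi I \<in> {1..jobs I} \<rightarrow>\<^sub>E {0..} \<and>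
     (\<forall>j\<in>{1..jobs I}. size_lo I j \<le> size_hi I j) \<and>
     weight I \<in> {1..jobs I} \<rightarrow>\<^sub>E {0<..} \<and>
     budget I \<ge> 0"

definition uncertainty_set :: "wbb_instance \<Rightarrow> scenario set" where
  "uncertainty_set I =
     {restricted_assignment (machines I) (jobs I) (eligible I) p | p.
        \<exists>T \<subseteq> {1..jobs I}. (\<Sum>j\<in>T. weight I j) \<le> budget I \<and>
          (\<forall>j\<in>{1..jobs I} - T. p j = size_lo I j) \<and>
          (\<forall>j\<in>T. p j \<in> {size_lo I j..size_hi I j})}"

lemma finite_schedules: "finite (schedules m n)"
  unfolding schedules_def by (rule finite_subset[of _ "{1..m} \<rightarrow>\<^sub>E Pow {1..n}"]) (auto intro: finite_PiE)

lemma schedules_nonempty: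
  assumes "m \<ge> 1"
  shows "schedules m n \<noteq> {}"
proof -
  have "(\<lambda>i\<in>{1..m}. if i = 1 then {1..n} else {}) \<in> schedules m n"
    using assms by (auto simp: schedules_def disjoint_family_on_def split: if_splits)
  then show ?thesis by blast
qed

lemma worst_case_attained:
  assumes I: "valid_instance I" and S: "S \<in> schedules (machines I) (jobs I)"
  shows "\<exists>q\<in>uncertainty_set I.
           C_max (machines I) S q = worst_case (machines I) S (uncertainty_set I)"
proof -
  define m n where "m = machines I" and "n = jobs I"
  define \<T> where "\<T> = {T. T \<subseteq> {1..n} \<and> (\<Sum>j\<in>T. weight I j) \<le> budget I}"
  define q where "q T = restricted_assignment m n (eligible I)
                         (\<lambda>j. if j \<in> T then size_hi I j else size_lo I j)" for T
  define f where "f r = C_max m S r" for r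
  have le: "size_lo I j \<le> size_hi I j" if "j \<in> {1..n}" for j
    using I that by (auto simp: valid_instance_def n_def)
  have qU: "q T \<in> uncertainty_set I" if "T \<in> \<T>" for T
    using that le unfolding uncertainty_set_def q_def \<T>_def m_def n_def
    by (auto intro!: exI[of _ "\<lambda>j. if j \<in> T then size_hi I j else size_lo I j"] exI[of _ T])
  have fin: "finite \<T>"
    unfolding \<T>_def by (rule finite_subset[of _ "Pow {1..n}"]) auto
  have ne: "\<T> \<noteq> {}"
    using I by (auto simp: \<T>_def valid_instance_def intro!: exI[of _ "{}"])
  have Ssub: "j \<in> {1..n}" if "i \<in> {1..m}" "j \<in> S i" for i j
    using S that unfolding schedules_def m_def n_def by blast
  have dom: "\<exists>T\<in>\<T>. f r \<le> f (q T)" if "r \<in> uncertainty_set I" for r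
  proof -
    from that obtain p T where r: "r = restricted_assignment m n (eligible I) p"
      and T: "T \<subseteq> {1..n}" "(\<Sum>j\<in>T. weight I j) \<le> budget I"
      and p: "\<forall>j\<in>{1..n} - T. p j = size_lo I j" "\<forall>j\<in>T. p j \<in> {size_lo I j..size_hi I j}"
      unfolding uncertainty_set_def m_def n_def by blast
    have pw: "r i j \<le> q T i j" if "i \<in> {1..m}" "j \<in> {1..n}" for i j
      using that p by (auto simp: r q_def restricted_assignment_def intro!: ennreal_leI)
    have load: "(\<Sum>j\<in>S i. r i j) \<le> (\<Sum>j\<in>S i. q T i j)" if "i \<in> {1..m}" for i
      using pw that Ssub by (intro sum_mono) blast
    have "f r \<le> f (q T)"
      unfolding f_def C_max_def
    proof (rule Max.boundedI)
      show "(\<lambda>i. \<Sum>j\<in>S i. r i j) ` {1..m} \<noteq> {}"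
        using I by (auto simp: valid_instance_def m_def)
      fix x assume "x \<in> (\<lambda>i. \<Sum>j\<in>S i. r i j) ` {1..m}"
      then obtain i where i: "i \<in> {1..m}" "x = (\<Sum>j\<in>S i. r i j)" by blast
      have "x \<le> (\<Sum>j\<in>S i. q T i j)" using load i by simp
      also have "\<dots> \<le> Max ((\<lambda>i. \<Sum>j\<in>S i. q T i j) ` {1..m})" using i by (intro Max_ge) auto
      finally show "x \<le> Max ((\<lambda>i. \<Sum>j\<in>S i. q T i j) ` {1..m})" .
    qed simp
    then show ?thesis using T by (auto simp: \<T>_def)
  qed
  have "Max ((\<lambda>T. f (q T)) ` \<T>) \<in> (\<lambda>T. f (q T)) ` \<T>"
    using fin ne by (intro Max_in) auto
  then obtain T where T: "T \<in> \<T>" "Max ((\<lambda>T. f (q T)) ` \<T>) = f (q T)" by blast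
  have mx: "f (q T') \<le> f (q T)" if "T' \<in> \<T>" for T'
    using that fin by (simp flip: T(2))
  have "(SUP r\<in>uncertainty_set I. f r) = f (q T)"
    using dom mx qU T(1) by (intro antisym SUP_least SUP_upper) (meson order_trans)+
  then show ?thesis
    using qU[OF T(1)] unfolding worst_case_def f_def m_def[symmetric] by auto
qed

end

theory Submission
  imports Defs
begin

text \<open>
  Let \<open>A = OPT(qhat)\<close> and \<open>R = OPT_rob(\<U>)\<close>; then \<open>A \<le> R\<close> as \<open>qhat \<in> \<U>\<close>. Charging a deviation of job
  \<open>j\<close> the price \<open>\<pi> w\<^sub>j\<close> with \<open>\<pi> = 2 R / \<Gamma>\<close> (if \<open>\<Gamma> = 0\<close>, no job deviates
  and \<open>\<pi> = 0\<close>) leaves the machine-independent size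
  \<open>r\<^sub>j = p\<^sub>j\<^sup>- + max 0 (p\<^sub>j\<^sup>+ - p\<^sub>j\<^sup>- - \<pi> w\<^sub>j)\<close>. The adversary pays at most \<open>\<pi> \<Gamma> \<le> 2 R\<close>, so
  a machine whose \<open>r\<close>-load is \<open>C\<close> has worst-case load at most \<open>C + 2 R\<close>. Conversely, the
  \<open>r\<close>-loads of a robust optimum \<open>Q\<close> are at most \<open>R\<close>: if the jobs \<open>j\<close> of a machine whose deviation exceeds
  \<open>\<pi> w\<^sub>j\<close> had total weight above \<open>\<Gamma>\<close>, then, as single weights are at most \<open>\<Gamma>\<close>, some of
  them would have total weight in \<open>[\<Gamma>/2, \<Gamma>]\<close> and could deviate by more than \<open>\<pi> \<Gamma> / 2 = R\<close>.

  Now merge a schedule \<open>P\<close> that is optimal for \<open>qhat\<close>, whose sizes are \<open>phat\<close>, with \<open>Q\<close>: a job follows \<open>P\<close> if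
  \<open>A r\<^sub>j < \<lambda> R phat\<^sub>j\<close> and \<open>Q\<close> otherwise. The former jobs have \<open>r\<close>-load at most \<open>\<lambda> R\<close>, and the
  latter ones have predicted load at most \<open>A / \<lambda>\<close>. Hence every predicted load is at most
  \<open>(1 + 1/\<lambda>) A\<close> and every worst-case load at most \<open>(2 + \<lambda> + 1) R \<le> (4 + 2 \<lambda>) R\<close>.
\<close>

section \<open>Schedules and their merging\<close>

lemma scheduleD:
  assumes "S \<in> schedules m n" "i \<in> {1..m}"
  shows "S i \<subseteq> {1..n}" "finite (S i)"
proof -
  show "S i \<subseteq> {1..n}"
    using assms by (auto simp: schedules_def PiE_iff)
  then show "finite (S i)"
    by (rule finite_subset) simp
qed

lemma schedule_job:
  assumes "S \<in> schedules m n" "j \<in> {1..n}"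
  obtains i where "i \<in> {1..m}" "j \<in> S i"
  using assms unfolding schedules_def by blast

lemma schedule_unique:
  assumes "S \<in> schedules m n" "i \<in> {1..m}" "k \<in> {1..m}" "j \<in> S i" "j \<in> S k"
  shows "i = k"
  using assms unfolding schedules_def disjoint_family_on_def by blast

text \<open>\<open>K\<close> holds the jobs that follow \<open>P\<close>. The restriction to
  \<open>{1..m}\<close> leaves \<open>undefined\<close> elsewhere, as \<open>schedules\<close>
  demands.\<close>

definition merge_schedules :: "nat \<Rightarrow> nat set \<Rightarrow> schedule \<Rightarrow> schedule \<Rightarrow> schedule" where
  "merge_schedules m K P Q = (\<lambda>i\<in>{1..m}. (P i \<inter> K) \<union> (Q i - K))"

lemma merge_schedules_in_schedules:
  assumes P: "P \<in> schedules m n" and Q: "Q \<in> schedules m n"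
  shows "merge_schedules m K P Q \<in> schedules m n"
proof -
  have "j \<in> (\<Union>i\<in>{1..m}. (P i \<inter> K) \<union> (Q i - K))" if j: "j \<in> {1..n}" for j
  proof -
    obtain i k where "i \<in> {1..m}" "j \<in> P i" "k \<in> {1..m}" "j \<in> Q k"
      using schedule_job[OF P j] schedule_job[OF Q j] by metis
    then show ?thesis by blast
  qed
  moreover have "(\<Union>i\<in>{1..m}. (P i \<inter> K) \<union> (Q i - K)) \<subseteq> {1..n}"
    using scheduleD(1)[OF P] scheduleD(1)[OF Q] by blast
  moreover have "disjoint_family_on (\<lambda>i\<in>{1..m}. (P i \<inter> K) \<union> (Q i - K)) {1..m}"
  proof -
    have "P i \<inter> P k = {}" "Q i \<inter> Q k = {}"
      if "i \<in> {1..m}" "k \<in> {1..m}" "i \<noteq> k" for i k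
      using schedule_unique[OF P that(1,2)] schedule_unique[OF Q that(1,2)] that(3) by blast+
    then show ?thesis
      unfolding disjoint_family_on_def by (simp add: disjoint_iff)
  qed
  ultimately show ?thesis
    unfolding schedules_def merge_schedules_def by auto
qed

lemma sum_merge_schedules:
  fixes p :: "nat \<Rightarrow> real"
  assumes P: "P \<in> schedules m n" and Q: "Q \<in> schedules m n" and i: "i \<in> {1..m}"
  shows "(\<Sum>j\<in>merge_schedules m K P Q i. p j) = (\<Sum>j\<in>P i \<inter> K. p j) + (\<Sum>j\<in>Q i - K. p j)"
proof -
  have merge: "merge_schedules m K P Q i = (P i \<inter> K) \<union> (Q i - K)"
    using i by (simp add: merge_schedules_def)
  then show ?thesis
    unfolding merge using scheduleD(2)[OF P i] scheduleD(2)[OF Q i]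
    by (intro sum.union_disjoint) auto
qed

text \<open>One ineligible job makes a load infinite, so a finite bound encodes eligibility. This
  passes from \<open>ennreal\<close> to linear inequalities over the reals.\<close>

lemma C_max_restricted_assignment_le_iff:
  assumes m: "m \<ge> 1" and S: "S \<in> schedules m n" and c: "c \<ge> 0"
    and p: "\<And>j. j \<in> {1..n} \<Longrightarrow> p j \<ge> 0"
  shows "C_max m S (restricted_assignment m n M p) \<le> ennreal c \<longleftrightarrow>
           (\<forall>i\<in>{1..m}. (\<forall>j\<in>S i. i \<in> M j) \<and> (\<Sum>j\<in>S i. p j) \<le> c)"
proof -
  let ?q = "restricted_assignment m n M p"
  have load: "(\<Sum>j\<in>S i. ?q i j) \<le> ennreal c \<longleftrightarrow> (\<forall>j\<in>S i. i \<in> M j) \<and> (\<Sum>j\<in>S i. p j) \<le> c"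
    if i: "i \<in> {1..m}" for i
  proof (cases "\<forall>j\<in>S i. i \<in> M j")
    case True
    have "(\<Sum>j\<in>S i. ?q i j) = (\<Sum>j\<in>S i. ennreal (p j))"
      using True i scheduleD(1)[OF S i] by (intro sum.cong) (auto simp: restricted_assignment_def)
    also have "\<dots> = ennreal (\<Sum>j\<in>S i. p j)"
      using scheduleD(1)[OF S i] p by (intro sum_ennreal) auto
    finally show ?thesis
      using True c by simp
  next
    case False
    then obtain j where j: "j \<in> S i" "i \<notin> M j" by blast
    then have "?q i j = \<infinity>"
      using i scheduleD(1)[OF S i] by (auto simp: restricted_assignment_def)
    then have "(\<Sum>j\<in>S i. ?q i j) = \<infinity>"
      using j scheduleD(2)[OF S i] by (auto intro!: bexI[of _ j])
    then show ?thesis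
      using False by (auto simp: top_unique)
  qed
  have "C_max m S ?q \<le> ennreal c \<longleftrightarrow> (\<forall>i\<in>{1..m}. (\<Sum>j\<in>S i. ?q i j) \<le> ennreal c)"
    unfolding C_max_def using m by (subst Max_le_iff) auto
  then show ?thesis
    using load by blast
qed

section \<open>Pricing of deviations\<close>

text \<open>If the set \<open>T\<close> found for \<open>F\<close> weighs less than half of
  \<Gamma>, it is all of \<open>F\<close>. Then \<open>x\<close> either weighs at least half of
  \<Gamma> and serves alone, or fits on top of \<open>F\<close>.\<close>

lemma exists_heavy_subset:
  fixes w :: "'a \<Rightarrow> real"
  assumes "finite H" and "\<And>x. x \<in> H \<Longrightarrow> w x \<le> \<Gamma>" and "\<Gamma> \<ge> 0"
  shows "\<exists>T\<subseteq>H. sum w T \<le> \<Gamma> \<and> (T = H \<or> \<Gamma> \<le> 2 * sum w T)"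
  using assms(1,2)
proof (induction H rule: finite_induct)
  case empty
  then show ?case using \<open>\<Gamma> \<ge> 0\<close> by simp
next
  case (insert x F)
  then obtain T where T: "T \<subseteq> F" "sum w T \<le> \<Gamma>" "T = F \<or> \<Gamma> \<le> 2 * sum w T"
    by auto
  consider "\<Gamma> \<le> 2 * sum w T" | "\<Gamma> \<le> 2 * w x" | "T = F" "w x + sum w F \<le> \<Gamma>"
    using T by fastforce
  then show ?case
  proof cases
    case 1
    then show ?thesis using T by blast
  next
    case 2
    then show ?thesis using insert.prems by (intro exI[of _ "{x}"]) auto
  next
    case 3
    then show ?thesis using insert.hyps by (intro exI[of _ "insert x F"]) auto
  qed
qed

text \<open>The jobs \<open>H\<close> whose deviation exceeds its price turn out to be affordable
  together, so \<open>rob\<close> bounds their full deviation. The priced load counts only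
  \<open>d j - \<pi> * w j\<close> on \<open>H\<close>, which is no larger.\<close>

lemma priced_load_le:
  fixes lo d w :: "'a \<Rightarrow> real"
  assumes fin: "finite X" and \<Gamma>: "\<Gamma> \<ge> 0" and R: "R \<ge> 0"
    and w: "\<And>j. j \<in> X \<Longrightarrow> w j > 0" and lo: "\<And>j. j \<in> X \<Longrightarrow> lo j \<ge> 0"
    and wd: "\<And>j. j \<in> X \<Longrightarrow> d j > 0 \<Longrightarrow> w j \<le> \<Gamma>"
    and rob: "\<And>T. T \<subseteq> X \<Longrightarrow> sum w T \<le> \<Gamma> \<Longrightarrow> sum lo X + sum d T \<le> R"
  shows "(\<Sum>j\<in>X. lo j + max 0 (d j - 2 * R / \<Gamma> * w j)) \<le> R"
proof -
  \<comment> \<open>Division by zero yields 0, the right price for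
    \<open>\<Gamma> = 0\<close>.\<close>
  define \<pi> where "\<pi> = 2 * R / \<Gamma>"
  have \<pi>: "\<pi> \<ge> 0" using \<Gamma> R by (simp add: \<pi>_def)
  define H where "H = {j \<in> X. d j > \<pi> * w j}"
  have H: "H \<subseteq> X" "finite H" using fin by (auto simp: H_def)
  have wH: "w j \<le> \<Gamma>" if "j \<in> H" for j
  proof -
    have "0 \<le> \<pi> * w j" using w[of j] H \<pi> that by (intro mult_nonneg_nonneg) force+
    then show ?thesis using that wd by (auto simp: H_def)
  qed
  obtain T where T: "T \<subseteq> H" "sum w T \<le> \<Gamma>" "T = H \<or> \<Gamma> \<le> 2 * sum w T"
    using exists_heavy_subset[of H w \<Gamma>, OF H(2) wH \<Gamma>] by blast
  have le: "sum lo X + sum d T \<le> R" using rob T H by blast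
  have "T = H"
  proof (rule ccontr)
    assume "T \<noteq> H"
    then obtain j where j: "j \<in> H" "\<Gamma> \<le> 2 * sum w T" using T by auto
    \<comment> \<open>A positive budget lets \<Gamma> cancel in \<pi> and makes \<open>T\<close>
      nonempty, as the strict sum comparison below requires.\<close>
    then have \<Gamma>: "\<Gamma> > 0" using w[of j] wH[of j] H by force
    have "T \<noteq> {}" using j \<Gamma> by auto
    have "R = \<pi> * (\<Gamma> / 2)" using \<Gamma> by (simp add: \<pi>_def)
    also have "\<dots> \<le> \<pi> * sum w T" using j \<pi> by (intro mult_left_mono) auto
    also have "\<dots> = (\<Sum>j\<in>T. \<pi> * w j)" by (simp add: sum_distrib_left)
    also have "\<dots> < sum d T"
      using T(1) \<open>T \<noteq> {}\<close> H by (intro sum_strict_mono) (auto simp: H_def intro: finite_subset)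
    also have "\<dots> \<le> R" using le sum_nonneg[of X lo] lo by force
    finally show False by simp
  qed
  have "(\<Sum>j\<in>X. max 0 (d j - \<pi> * w j)) = (\<Sum>j\<in>H. d j - \<pi> * w j)"
    by (rule sum.mono_neutral_cong_right) (use fin in \<open>auto simp: H_def\<close>)
  also have "\<dots> \<le> sum d H"
    using \<pi> w H by (intro sum_mono) (simp add: less_imp_le subset_iff)
  finally show ?thesis
    using le \<open>T = H\<close> by (simp add: sum.distrib flip: \<pi>_def)
qed

section \<open>Worst-case loads over the uncertainty set\<close>

lemma uncertainty_set_nonneg:
  assumes "valid_instance I" and "T \<subseteq> {1..jobs I}"
    and "\<forall>j\<in>{1..jobs I} - T. p j = size_lo I j" "\<forall>j\<in>T. p j \<in> {size_lo I j..size_hi I j}"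
    and "j \<in> {1..jobs I}"
  shows "0 \<le> p j" "p j \<le> size_hi I j"
proof -
  have "0 \<le> size_lo I j" "size_lo I j \<le> size_hi I j"
    using assms(1,5) by (auto simp: valid_instance_def PiE_iff)
  then show "0 \<le> p j" "p j \<le> size_hi I j"
    using assms(3-5) by (cases "j \<in> T"; force)+
qed

text \<open>Read from left to right it tests a robust schedule on chosen scenarios; from right to
  left it certifies new bounds.\<close>

lemma worst_case_le_iff:
  assumes I: "valid_instance I" and S: "S \<in> schedules (machines I) (jobs I)" and c: "c \<ge> 0"
  shows "worst_case (machines I) S (uncertainty_set I) \<le> ennreal c \<longleftrightarrow>
    (\<forall>p T. T \<subseteq> {1..jobs I} \<and> (\<Sum>j\<in>T. weight I j) \<le> budget I \<and>
       (\<forall>j\<in>{1..jobs I} - T. p j = size_lo I j) \<and>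
       (\<forall>j\<in>T. p j \<in> {size_lo I j..size_hi I j}) \<longrightarrow>
       (\<forall>i\<in>{1..machines I}. (\<forall>j\<in>S i. i \<in> eligible I j) \<and> (\<Sum>j\<in>S i. p j) \<le> c))"
    (is "_ \<longleftrightarrow> (\<forall>p T. ?scen p T \<longrightarrow> ?bound p)")
proof -
  have m: "machines I \<ge> 1" using I by (simp add: valid_instance_def)
  define scen where "scen p T \<longleftrightarrow> ?scen p T" for p T
  define ra where "ra = restricted_assignment (machines I) (jobs I) (eligible I)"
  have C_le: "C_max (machines I) S (ra p) \<le> ennreal c \<longleftrightarrow> ?bound p" if "scen p T" for p T
    unfolding ra_def using that uncertainty_set_nonneg(1)[OF I, of T p]
    by (intro C_max_restricted_assignment_le_iff[OF m S c]) (simp add: scen_def)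
  have "uncertainty_set I = {ra p | p. \<exists>T. scen p T}"
    by (simp add: uncertainty_set_def ra_def scen_def)
  then have "worst_case (machines I) S (uncertainty_set I) \<le> ennreal c \<longleftrightarrow>
      (\<forall>p T. scen p T \<longrightarrow> C_max (machines I) S (ra p) \<le> ennreal c)"
    unfolding worst_case_def SUP_le_iff by auto
  also have "\<dots> \<longleftrightarrow> (\<forall>p T. scen p T \<longrightarrow> ?bound p)"
    by (simp add: C_le cong: imp_cong)
  finally show ?thesis
    unfolding scen_def .
qed

section \<open>Merging a predicted and a robust schedule\<close>

text \<open>In \<open>3 + lam\<close>, the jobs placed as in \<open>P\<close> account for
  \<open>lam\<close>, those placed as in \<open>Q\<close> for 1, and the price of the whole budget
  for 2.\<close>

lemma merged_schedule_exists:
  fixes lam A R :: real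
  assumes I: "valid_instance I"
    and wd: "\<forall>j\<in>{1..jobs I}. size_hi I j - size_lo I j > 0 \<longrightarrow> weight I j \<le> budget I"
    and lam: "lam > 0" and A: "0 \<le> A" "A \<le> R"
    and P: "P \<in> schedules (machines I) (jobs I)" and Q: "Q \<in> schedules (machines I) (jobs I)"
    and ph: "\<And>j. j \<in> {1..jobs I} \<Longrightarrow> 0 \<le> ph j"
    and PA: "\<forall>i\<in>{1..machines I}. (\<forall>j\<in>P i. i \<in> eligible I j) \<and> (\<Sum>j\<in>P i. ph j) \<le> A"
    and QR: "worst_case (machines I) Q (uncertainty_set I) \<le> ennreal R"
  shows "\<exists>S\<in>schedules (machines I) (jobs I).
    (\<forall>i\<in>{1..machines I}. (\<forall>j\<in>S i. i \<in> eligible I j) \<and> (\<Sum>j\<in>S i. ph j) \<le> (1 + 1 / lam) * A) \<and>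
    worst_case (machines I) S (uncertainty_set I) \<le> ennreal ((3 + lam) * R)"
proof -
  define lo d w \<Gamma> where "lo = size_lo I" and "d j = size_hi I j - size_lo I j"
    and "w = weight I" and "\<Gamma> = budget I" for j
  define \<pi> where "\<pi> = 2 * R / \<Gamma>"
  define r where "r j = lo j + max 0 (d j - \<pi> * w j)" for j
  \<comment> \<open>Compares \<open>r j / (lam * R)\<close> with \<open>ph j / A\<close>, multiplied
    out because \<open>A\<close> and \<open>R\<close> may be 0.\<close>
  define K where "K = {j. A * r j < lam * R * ph j}"
  define S where "S = merge_schedules (machines I) K P Q"
  have R: "R \<ge> 0" using A by simp
  have \<Gamma>: "\<Gamma> \<ge> 0" and w: "\<And>j. j \<in> {1..jobs I} \<Longrightarrow> w j > 0"
    and lo: "\<And>j. j \<in> {1..jobs I} \<Longrightarrow> lo j \<ge> 0"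
    and d: "\<And>j. j \<in> {1..jobs I} \<Longrightarrow> d j \<ge> 0"
    using I by (auto simp: valid_instance_def PiE_iff \<Gamma>_def w_def lo_def d_def)
  have \<pi>: "\<pi> \<ge> 0" "\<pi> * \<Gamma> \<le> 2 * R" using R \<Gamma> by (simp_all add: \<pi>_def)
  have r0: "r j \<ge> 0" if "j \<in> {1..jobs I}" for j using lo[OF that] by (simp add: r_def)
  have S: "S \<in> schedules (machines I) (jobs I)"
    unfolding S_def by (rule merge_schedules_in_schedules[OF P Q])
  note Q_rob = QR[unfolded worst_case_le_iff[OF I Q R], rule_format]
  have Q_elig: "i \<in> eligible I j" if "i \<in> {1..machines I}" "j \<in> Q i" for i j
    \<comment> \<open>Eligibility is the same in all scenarios, so the one without deviations
      suffices.\<close>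
    using Q_rob[of "{}" lo i] that \<Gamma> by (auto simp: lo_def \<Gamma>_def)
  have S_elig: "i \<in> eligible I j" if "i \<in> {1..machines I}" "j \<in> S i" for i j
    using that PA Q_elig by (auto simp: S_def merge_schedules_def)
  have Q_load: "(\<Sum>j\<in>Q i. r j) \<le> R" if i: "i \<in> {1..machines I}" for i
    unfolding r_def \<pi>_def
  proof (rule priced_load_le)
    fix T assume T: "T \<subseteq> Q i" "sum w T \<le> \<Gamma>"
    \<comment> \<open>The scenario in which exactly the jobs of \<open>T\<close> reach their upper
      sizes.\<close>
    let ?p = "\<lambda>j. lo j + (if j \<in> T then d j else 0)"
    have "sum lo (Q i) + sum d T = sum ?p (Q i)"
      using T(1) scheduleD(2)[OF Q i]
      by (simp add: sum.distrib sum.If_cases Int_absorb1)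
    also have "\<dots> \<le> R"
      using Q_rob[of T ?p i] T scheduleD(1)[OF Q i] i d
      by (auto simp: lo_def d_def w_def \<Gamma>_def subset_iff)
    finally show "sum lo (Q i) + sum d T \<le> R" .
  next
    fix j assume "j \<in> Q i"
    then have j: "j \<in> {1..jobs I}" using scheduleD(1)[OF Q i] by blast
    show "w j > 0" "lo j \<ge> 0" using w lo j by auto
    show "w j \<le> \<Gamma>" if "d j > 0" using wd j that by (auto simp: w_def \<Gamma>_def d_def)
  qed (use scheduleD(2)[OF Q i] \<Gamma> R in auto)
  have stay: "(\<Sum>j\<in>P i \<inter> K. r j) \<le> lam * R" if i: "i \<in> {1..machines I}" for i
  proof (cases "A = 0")
    case True
    \<comment> \<open>All predicted sizes on \<open>P i\<close> vanish, so the strict inequality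
      defining \<open>K\<close> fails there.\<close>
    have "(\<Sum>j\<in>P i. ph j) = 0"
      using PA i True ph scheduleD(1)[OF P i] by (intro antisym sum_nonneg) auto
    then have "\<forall>j\<in>P i. ph j = 0"
      using ph scheduleD[OF P i] by (subst (asm) sum_nonneg_eq_0_iff) auto
    then have "P i \<inter> K = {}" using True by (auto simp: K_def)
    then show ?thesis using lam R by simp
  next
    case False
    have "A * (\<Sum>j\<in>P i \<inter> K. r j) \<le> lam * R * (\<Sum>j\<in>P i \<inter> K. ph j)"
      unfolding sum_distrib_left by (intro sum_mono) (auto simp: K_def)
    also have "\<dots> \<le> lam * R * (\<Sum>j\<in>P i. ph j)"
      using lam R ph scheduleD[OF P i] by (intro mult_left_mono sum_mono2) auto
    also have "\<dots> \<le> lam * R * A"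
      using lam R PA i by (intro mult_left_mono) auto
    finally show ?thesis using False A by (simp add: mult.commute)
  qed
  have move: "(\<Sum>j\<in>Q i - K. ph j) \<le> A / lam" if i: "i \<in> {1..machines I}" for i
  proof (cases "R = 0")
    case True
    \<comment> \<open>Here \<open>A \<le> R\<close> matters: every job lies on some machine of
      \<open>P\<close>, whose predicted load is now 0.\<close>
    then have "A = 0" using A by simp
    have "ph j = 0" if j: "j \<in> {1..jobs I}" for j
    proof -
      obtain k where k: "k \<in> {1..machines I}" "j \<in> P k" using schedule_job[OF P j] .
      have "ph j \<le> (\<Sum>j\<in>P k. ph j)"
        using k ph scheduleD[OF P k(1)] by (intro member_le_sum) auto
      also have "\<dots> \<le> 0" using PA k \<open>A = 0\<close> by auto
      finally show ?thesis using ph[OF j] by simp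
    qed
    then have "(\<Sum>j\<in>Q i - K. ph j) = 0"
      using scheduleD(1)[OF Q i] by (intro sum.neutral) auto
    then show ?thesis using A lam by simp
  next
    case False
    have "lam * R * (\<Sum>j\<in>Q i - K. ph j) \<le> A * (\<Sum>j\<in>Q i - K. r j)"
      unfolding sum_distrib_left by (intro sum_mono) (auto simp: K_def)
    also have "\<dots> \<le> A * (\<Sum>j\<in>Q i. r j)"
      using A r0 scheduleD[OF Q i] by (intro mult_left_mono sum_mono2) auto
    also have "\<dots> \<le> A * R" using A Q_load[OF i] by (intro mult_left_mono) auto
    finally have "R * (lam * (\<Sum>j\<in>Q i - K. ph j)) \<le> R * A" by (simp add: ac_simps)
    then show ?thesis using False R lam by (simp add: field_simps)
  qed
  have consistent: "(\<Sum>j\<in>S i. ph j) \<le> (1 + 1 / lam) * A" if i: "i \<in> {1..machines I}" for i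
  proof -
    have "(\<Sum>j\<in>P i \<inter> K. ph j) \<le> (\<Sum>j\<in>P i. ph j)"
      using ph scheduleD[OF P i] by (intro sum_mono2) auto
    then have "(\<Sum>j\<in>P i \<inter> K. ph j) \<le> A" using PA i by force
    then show ?thesis
      using move[OF i] unfolding S_def sum_merge_schedules[OF P Q i] by (simp add: algebra_simps)
  qed
  have S_load: "(\<Sum>j\<in>S i. r j) \<le> lam * R + R" if i: "i \<in> {1..machines I}" for i
  proof -
    have "(\<Sum>j\<in>Q i - K. r j) \<le> (\<Sum>j\<in>Q i. r j)"
      using r0 scheduleD[OF Q i] by (intro sum_mono2) auto
    then show ?thesis
      using stay[OF i] Q_load[OF i] unfolding S_def sum_merge_schedules[OF P Q i] by simp
  qed
  have robust: "(\<Sum>j\<in>S i. p j) \<le> (3 + lam) * R"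
    if i: "i \<in> {1..machines I}" and T: "T \<subseteq> {1..jobs I}" "sum w T \<le> \<Gamma>"
      and p: "\<forall>j\<in>{1..jobs I} - T. p j = lo j" "\<forall>j\<in>T. p j \<in> {lo j..size_hi I j}" for i p T
  proof -
    have "(\<Sum>j\<in>S i \<inter> T. w j) \<le> sum w T"
      using w T finite_subset[OF T(1)] by (intro sum_mono2) (auto simp: less_imp_le subset_iff)
    then have deviation: "\<pi> * (\<Sum>j\<in>S i \<inter> T. w j) \<le> \<pi> * \<Gamma>"
      using T \<pi> by (intro mult_left_mono) auto
    have "(\<Sum>j\<in>S i. p j) \<le> (\<Sum>j\<in>S i. r j + (if j \<in> T then \<pi> * w j else 0))"
    proof (rule sum_mono)
      fix j assume "j \<in> S i"
      then have j: "j \<in> {1..jobs I}" using scheduleD(1)[OF S i] by blast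
      \<comment> \<open>A deviation is at most its price plus the excess already contained in
        \<open>r j\<close>.\<close>
      show "p j \<le> r j + (if j \<in> T then \<pi> * w j else 0)"
      proof (cases "j \<in> T")
        case True
        then have "p j \<le> lo j + d j" using p by (auto simp: lo_def d_def)
        then show ?thesis using True by (auto simp: r_def)
      next
        case False
        then show ?thesis using p j by (auto simp: r_def)
      qed
    qed
    also have "\<dots> = (\<Sum>j\<in>S i. r j) + \<pi> * (\<Sum>j\<in>S i \<inter> T. w j)"
      using scheduleD(2)[OF S i] by (simp add: sum.distrib sum.If_cases sum_distrib_left)
    finally show ?thesis using S_load[OF i] \<pi> deviation by (simp add: algebra_simps)
  qed
  have "worst_case (machines I) S (uncertainty_set I) \<le> ennreal ((3 + lam) * R)"
    using robust S_elig lam R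
    by (subst worst_case_le_iff[OF I S]) (auto simp: lo_def w_def \<Gamma>_def)
  then show ?thesis using S consistent S_elig by blast
qed

text \<open>Since eligibility is fixed, both optima are finite or both infinite; in the finite case
  the merging argument applies to their real values.\<close>

lemma schedule_exists:
  fixes lam :: real
  assumes lam: "lam > 0" and I: "valid_instance I"
    and wd: "\<forall>j\<in>{1..jobs I}. size_hi I j - size_lo I j > 0 \<longrightarrow> weight I j \<le> budget I"
    and qhat: "qhat \<in> uncertainty_set I"
  shows "\<exists>S\<in>schedules (machines I) (jobs I).
    C_max (machines I) S qhat \<le> ennreal (1 + 1 / lam) * OPT (machines I) (jobs I) qhat \<and>
    worst_case (machines I) S (uncertainty_set I)
      \<le> ennreal (4 + 2 * lam) * OPT_rob (machines I) (jobs I) (uncertainty_set I)"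
proof -
  let ?m = "machines I" and ?n = "jobs I" and ?U = "uncertainty_set I"
  let ?A = "OPT ?m ?n qhat" and ?R = "OPT_rob ?m ?n ?U"
  have m: "?m \<ge> 1" using I by (simp add: valid_instance_def)
  note fin = finite_schedules[of ?m ?n] and ne = schedules_nonempty[OF m, of ?n]
  have "?A \<in> (\<lambda>S. C_max ?m S qhat) ` schedules ?m ?n"
    unfolding OPT_def using fin ne by (intro Min_in) auto
  then obtain P where P: "P \<in> schedules ?m ?n" "?A = C_max ?m P qhat" by blast
  have "?R \<in> (\<lambda>S. worst_case ?m S ?U) ` schedules ?m ?n"
    unfolding OPT_rob_def using fin ne by (intro Min_in) auto
  then obtain Q where Q: "Q \<in> schedules ?m ?n" "?R = worst_case ?m Q ?U" by blast
  have "?A \<le> C_max ?m Q qhat"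
    unfolding OPT_def using fin Q by (intro Min_le) auto
  also have "\<dots> \<le> ?R"
    unfolding Q(2) worst_case_def using qhat by (rule SUP_upper)
  finally have AR: "?A \<le> ?R" .
  show ?thesis
  proof (cases "?A = \<infinity>")
    case True
    \<comment> \<open>Both guarantees have an infinite right-hand side, so any schedule will
      do.\<close>
    then have "?R = \<infinity>" using AR by (simp add: top_unique)
    then show ?thesis
      using P True lam by (auto simp: ennreal_mult_top add_pos_pos intro!: bexI[of _ P])
  next
    case False
    then obtain a where a: "?A = ennreal a" "0 \<le> a" by (cases ?A) auto
    obtain ph T where ph: "qhat = restricted_assignment ?m ?n (eligible I) ph"
      and scen: "T \<subseteq> {1..?n}" "\<forall>j\<in>{1..?n} - T. ph j = size_lo I j"
        "\<forall>j\<in>T. ph j \<in> {size_lo I j..size_hi I j}"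
      using qhat unfolding uncertainty_set_def by blast
    note ph0 = uncertainty_set_nonneg(1)[OF I scen]
    have PA: "\<forall>i\<in>{1..?m}. (\<forall>j\<in>P i. i \<in> eligible I j) \<and> (\<Sum>j\<in>P i. ph j) \<le> a"
      using C_max_restricted_assignment_le_iff[of ?m P ?n a ph "eligible I", OF m P(1) a(2) ph0]
        P(2) a(1) by (simp add: ph)
    have hi0: "0 \<le> size_hi I j" if "j \<in> {1..?n}" for j
      using I that by (auto simp: valid_instance_def PiE_iff)
    have hi: "(\<Sum>j\<in>P i. p j) \<le> (\<Sum>j\<in>{1..?n}. size_hi I j)"
      if "i \<in> {1..?m}" "T \<subseteq> {1..?n}" "\<forall>j\<in>{1..?n} - T. p j = size_lo I j"
        "\<forall>j\<in>T. p j \<in> {size_lo I j..size_hi I j}" for i p T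
    proof -
      have "(\<Sum>j\<in>P i. p j) \<le> (\<Sum>j\<in>P i. size_hi I j)"
        using uncertainty_set_nonneg(2)[OF I that(2-4)] scheduleD(1)[OF P(1) that(1)]
        by (intro sum_mono) blast
      also have "\<dots> \<le> (\<Sum>j\<in>{1..?n}. size_hi I j)"
        using hi0 scheduleD(1)[OF P(1) that(1)] by (intro sum_mono2) auto
      finally show ?thesis .
    qed
    \<comment> \<open>\<open>P\<close> respects eligibility, so its worst case, and hence
      \<open>?R\<close>, is at most the total of the upper sizes.\<close>
    have "?R \<le> worst_case ?m P ?U"
      unfolding OPT_rob_def using fin P by (intro Min_le) auto
    also have "\<dots> \<le> ennreal (\<Sum>j\<in>{1..?n}. size_hi I j)"
      by (subst worst_case_le_iff[OF I P(1)]) (use PA hi hi0 in \<open>auto intro!: sum_nonneg\<close>)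
    finally obtain b where b: "?R = ennreal b" "0 \<le> b" by (cases ?R) (auto simp: top_unique)
    have "a \<le> b" using AR a b by simp
    have "worst_case ?m Q ?U \<le> ennreal b" using Q b by simp
    then obtain S where S: "S \<in> schedules ?m ?n"
      "\<forall>i\<in>{1..?m}. (\<forall>j\<in>S i. i \<in> eligible I j) \<and> (\<Sum>j\<in>S i. ph j) \<le> (1 + 1 / lam) * a"
      "worst_case ?m S ?U \<le> ennreal ((3 + lam) * b)"
      using merged_schedule_exists[OF I wd lam a(2) \<open>a \<le> b\<close> P(1) Q(1) ph0 PA] by blast
    have "C_max ?m S qhat \<le> ennreal ((1 + 1 / lam) * a)"
      unfolding ph using lam a S(2)
      by (subst C_max_restricted_assignment_le_iff[OF m S(1) _ ph0]) auto
    moreover have "worst_case ?m S ?U \<le> ennreal ((4 + 2 * lam) * b)"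
      using S(3) by (rule order_trans) (use lam b in \<open>intro ennreal_leI mult_right_mono; simp\<close>)
    ultimately show ?thesis
      using S(1) lam a b by (auto simp: ennreal_mult)
  qed
qed

theorem theorem20:
  fixes lam :: real
  assumes "lam > 0"
  shows "\<exists>alg :: wbb_instance \<Rightarrow> scenario \<Rightarrow> schedule.
    \<forall>I qhat.
      valid_instance I \<and>
      (\<forall>j\<in>{1..jobs I}. size_hi I j - size_lo I j > 0 \<longrightarrow> weight I j \<le> budget I) \<and>
      qhat \<in> uncertainty_set I \<longrightarrow>
        alg I qhat \<in> schedules (machines I) (jobs I) \<and>
        C_max (machines I) (alg I qhat) qhat
          \<le> ennreal (1 + 1 / lam) * OPT (machines I) (jobs I) qhat \<and>
        worst_case (machines I) (alg I qhat) (uncertainty_set I)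
          \<le> ennreal (4 + 2 * lam) * OPT_rob (machines I) (jobs I) (uncertainty_set I)"
proof -
  \<comment> \<open>With the implication inside the existential, the axiom of choice yields a total
    map \<open>alg\<close>.\<close>
  have "\<forall>I qhat. \<exists>S.
      valid_instance I \<and>
      (\<forall>j\<in>{1..jobs I}. size_hi I j - size_lo I j > 0 \<longrightarrow> weight I j \<le> budget I) \<and>
      qhat \<in> uncertainty_set I \<longrightarrow>
        S \<in> schedules (machines I) (jobs I) \<and>
        C_max (machines I) S qhat
          \<le> ennreal (1 + 1 / lam) * OPT (machines I) (jobs I) qhat \<and>
        worst_case (machines I) S (uncertainty_set I)
          \<le> ennreal (4 + 2 * lam) * OPT_rob (machines I) (jobs I) (uncertainty_set I)"
    using schedule_exists[OF assms] by blast
  then show ?thesis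
    unfolding choice_iff .
qed

end
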